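(* Let $n\ge5$, let $B\in\mathcal{COP}^{n-5}$, let $C\in\mathbb{R}^{(n-5)\times5}$ have nonnegative entries, let $J\in\mathbb{R}^{n\times n}$ be a permutation matrix, let $D\in\mathcal{S}^n$ be a diagonal matrix with strictly positive diagonal entries, and let $\lambda\in\mathbb{R}$. Let $H$ be the Horn matrix and define $$\widehat{M}=\begin{bmatrix}B&C\\C^T&H\end{bmatrix}\in\mathcal{S}^n,\qquad M=JD\widehat{M}DJ^T,\qquad Q=\lambda E+M$$ (for $n=5$ the blocks $B$ and $C$ are absent and $\widehat{M}=H$). Then $M\in\partial\,\mathcal{COP}^n\setminus\mathcal{SPN}^n$, and consequently $Q\in\mathcal{S}^n\setminus\mathcal{Q}^n$ (i.e., $\ell(Q)<\nu(Q)$), $\nu(Q)=\lambda$, and $\Omega(Q)=\mathbf{V}^M$.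
   Context: $\mathcal{S}^n$ is the space of real symmetric $n\times n$ matrices, with trace inner product $\langle U,V\rangle=\sum_{i,j}U_{ij}V_{ij}$; $e\in\mathbb{R}^n$ is the all-ones vector, $E=ee^T$; $\Delta_n=\{x\in\mathbb{R}^n: e^Tx=1,\ x\ge 0\}$. $\mathcal{DN}^n$ is the cone of matrices in $\mathcal{S}^n$ that are both positive semidefinite and entrywise nonnegative. $\mathcal{SPN}^n$ is the cone of matrices in $\mathcal{S}^n$ that are the sum of a positive semidefinite matrix and an entrywise nonnegative symmetric matrix. $\mathcal{COP}^n=\{M\in\mathcal{S}^n: u^TMu\ge0\ \text{for all } u\in\mathbb{R}^n,\ u\ge0\}$ is the copositive cone, and its boundary is $\partial\,\mathcal{COP}^n=\{M\in\mathcal{COP}^n:\exists\,u\in\Delta_n\text{ with }u^TMu=0\}$. For $M\in\partial\,\mathcal{COP}^n$, $\mathbf{V}^M=\{u\in\Delta_n:u^TMu=0\}$. For $Q\in\mathcal{S}^n$: $\nu(Q)=\min\{x^TQx: x\in\Delta_n\}$, $\Omega(Q)=\{x\in\Delta_n:x^TQx=\nu(Q)\}$, and $\ell(Q)=\min\{\langle Q,X\rangle:\langle E,X\rangle=1,\ X\in\mathcal{DN}^n\}$. $\mathcal{Q}^n=\{Q\in\mathcal{S}^n:\ell(Q)=\nu(Q)\}$; one always has $\ell(Q)\le\nu(Q)$. The Horn matrix is $$H=\begin{bmatrix}1&-1&1&1&-1\\-1&1&-1&1&1\\1&-1&1&-1&1\\1&1&-1&1&-1\\-1&1&1&-1&1\end{bmatrix},$$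 which is known to satisfy $H\in\partial\,\mathcal{COP}^5\setminus\mathcal{SPN}^5$. *)

theory Defs
  imports Complex_Main "HOL-Combinatorics.Permutations" "Jordan_Normal_Form.Matrix"
begin

text \<open>
  The dimension \<open>n\<close> is an ordinary natural number, since block sizes such as \<open>n - 5\<close>
  (possibly \<open>0\<close>) occur; the matrix type used here admits empty matrices, and
  \<open>four_block_mat\<close> with an empty leading block returns its last block.
\<close>

definition sym_mats :: "nat \<Rightarrow> real mat set" where
  "sym_mats n = {M \<in> carrier_mat n n. M\<^sup>T = M}"

definition trace_inner :: "real mat \<Rightarrow> real mat \<Rightarrow> real" where
  "trace_inner U V = (\<Sum>i<dim_row U. \<Sum>j<dim_col U. U $$ (i, j) * V $$ (i, j))"

definition quad_form :: "real mat \<Rightarrow> real vec \<Rightarrow> real" where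
  "quad_form M u = u \<bullet> (M *\<^sub>v u)"

definition ones_vec :: "nat \<Rightarrow> real vec" where
  "ones_vec n = vec n (\<lambda>_. 1)"

definition ones_mat :: "nat \<Rightarrow> real mat" where
  "ones_mat n = mat n n (\<lambda>(i, j). ones_vec n $ i * ones_vec n $ j)"

definition std_simplex :: "nat \<Rightarrow> real vec set" where
  "std_simplex n = {x \<in> carrier_vec n. ones_vec n \<bullet> x = 1 \<and> 0\<^sub>v n \<le> x}"

definition nonneg_mat :: "real mat \<Rightarrow> bool" where
  "nonneg_mat A \<longleftrightarrow> (\<forall>i<dim_row A. \<forall>j<dim_col A. 0 \<le> A $$ (i, j))"

definition psd_mats :: "nat \<Rightarrow> real mat set" where
  "psd_mats n = {M \<in> sym_mats n. \<forall>u\<in>carrier_vec n. 0 \<le> quad_form M u}"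

definition DN :: "nat \<Rightarrow> real mat set" where
  "DN n = {M \<in> psd_mats n. nonneg_mat M}"

definition SPN :: "nat \<Rightarrow> real mat set" where
  "SPN n = {S + N | S N. S \<in> psd_mats n \<and> N \<in> sym_mats n \<and> nonneg_mat N}"

definition COP :: "nat \<Rightarrow> real mat set" where
  "COP n = {M \<in> sym_mats n. \<forall>u\<in>carrier_vec n. 0\<^sub>v n \<le> u \<longrightarrow> 0 \<le> quad_form M u}"

definition bd_COP :: "nat \<Rightarrow> real mat set" where
  "bd_COP n = {M \<in> COP n. \<exists>u\<in>std_simplex n. quad_form M u = 0}"

definition zero_set :: "nat \<Rightarrow> real mat \<Rightarrow> real vec set" where
  "zero_set n M = {u \<in> std_simplex n. quad_form M u = 0}"

text \<open>
  Both minima below are over nonempty compact sets when \<open>n \<ge> 1\<close>, so they are attained and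
  \<open>LEAST\<close> denotes the minimum itself (not merely an infimum).
\<close>

definition nu :: "nat \<Rightarrow> real mat \<Rightarrow> real" where
  "nu n Q = (LEAST v. v \<in> {quad_form Q x | x. x \<in> std_simplex n})"

definition Omega :: "nat \<Rightarrow> real mat \<Rightarrow> real vec set" where
  "Omega n Q = {x \<in> std_simplex n. quad_form Q x = nu n Q}"

definition ell :: "nat \<Rightarrow> real mat \<Rightarrow> real" where
  "ell n Q =
    (LEAST v. v \<in> {trace_inner Q X | X. trace_inner (ones_mat n) X = 1 \<and> X \<in> DN n})"

definition exact_mats :: "nat \<Rightarrow> real mat set" where
  "exact_mats n = {Q \<in> sym_mats n. ell n Q = nu n Q}"

definition horn_mat :: "real mat" where
  "horn_mat = mat_of_rows_list 5
    [[ 1, -1,  1,  1, -1],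
     [-1,  1, -1,  1,  1],
     [ 1, -1,  1, -1,  1],
     [ 1,  1, -1,  1, -1],
     [-1,  1,  1, -1,  1]]"

definition permutation_mat :: "nat \<Rightarrow> real mat \<Rightarrow> bool" where
  "permutation_mat n J \<longleftrightarrow>
    (\<exists>p. p permutes {..<n} \<and> J = mat n n (\<lambda>(i, j). if i = p j then 1 else 0))"

end

theory Submission
  imports Defs "HOL-Analysis.Function_Topology"
begin

text \<open>
  Adding \<open>\<lambda>E\<close> shifts both optimal values by \<open>\<lambda>\<close>, because \<open>\<langle>E, X\<rangle> = 1\<close> on either feasible set.
  The matrix \<open>M\<close> is copositive with a zero on the simplex, so \<open>\<nu>(M) = 0\<close> and its minimisers are
  its zeros. The strict gap and \<open>M \<notin> SPN\<close> both reduce to finding one doubly nonnegative \<open>X\<close> with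
  \<open>\<langle>M, X\<rangle> < 0\<close>. Such an \<open>X\<close> separates \<open>M\<close> from \<open>SPN\<close>, since a doubly nonnegative matrix has
  nonnegative inner product with positive semidefinite and with nonnegative matrices; and after
  normalisation it is feasible for the relaxation, with negative value
  (\<open>not_SPN_if_gram\<close>, \<open>ell_shift_less\<close>).

  For the Horn matrix the separating matrix is explicit. The sum of \<open>w w\<^sup>T\<close> over the five
  rotations \<open>w\<close> of \<open>(12, 6, -1, -1, 6)\<close> is positive semidefinite by construction. It is the
  circulant matrix with \<open>218\<close> on the diagonal, \<open>133\<close> at cyclic distance 1 and \<open>0\<close> at distance 2.
  So it is entrywise nonnegative, and its inner product with the Horn matrix is
  \<open>5 * 218 - 10 * 133 = -240\<close>. Padding the vectors with zeros carries the witness to the block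
  matrix, and \<open>v = J D\<^sup>-\<^sup>1 w\<close> carries a padded \<open>w\<close> through the congruence by \<open>J D\<close>:
  \<open>v\<^sup>T M v\<close> is the value of the block form at \<open>w\<close>, and entries of the Gram matrix are only
  permuted and divided by positive numbers.

  Since \<open>ell\<close> is a least element, all this bounds it only once the relaxation is known to attain
  its minimum; \<open>ell_le\<close> proves that by compactness. Copositivity of the Horn matrix
  comes from two algebraic identities (\<open>horn_nonneg\<close>), and copositivity passes to the block
  matrix because the coupling term \<open>2 y\<^sup>T C z\<close> is nonnegative.
\<close>

section \<open>Quadratic forms and inner products as double sums\<close>

lemma quad_form_eq_sum:
  assumes "M \<in> carrier_mat n n" "u \<in> carrier_vec n"
  shows "quad_form M u = (\<Sum>i<n. \<Sum>j<n. M $$ (i, j) * (u $ i * u $ j))"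
  using assms
  by (auto simp: quad_form_def scalar_prod_def lessThan_atLeast0 sum_distrib_left
      intro!: sum.cong)

lemma trace_inner_eq_sum:
  assumes "U \<in> carrier_mat n n"
  shows "trace_inner U V = (\<Sum>i<n. \<Sum>j<n. U $$ (i, j) * V $$ (i, j))"
  using assms by (simp add: trace_inner_def)

lemma quad_form_add:
  assumes "A \<in> carrier_mat n n" "A' \<in> carrier_mat n n" "u \<in> carrier_vec n"
  shows "quad_form (A + A') u = quad_form A u + quad_form A' u"
  using assms by (simp add: quad_form_eq_sum[of _ n] sum.distrib algebra_simps)

lemma quad_form_smult_vec:
  assumes "M \<in> carrier_mat n n" "u \<in> carrier_vec n"
  shows "quad_form M (c \<cdot>\<^sub>v u) = c\<^sup>2 * quad_form M u"
  using assms by (simp add: quad_form_eq_sum[of _ n] sum_distrib_left power2_eq_square algebra_simps)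

lemma ones_mat_carrier [simp]: "ones_mat n \<in> carrier_mat n n"
  by (simp add: ones_mat_def)

lemma ones_mat_dim [simp]: "dim_row (ones_mat n) = n" "dim_col (ones_mat n) = n"
  by (simp_all add: ones_mat_def)

lemma ones_mat_index [simp]: "i < n \<Longrightarrow> j < n \<Longrightarrow> ones_mat n $$ (i, j) = 1"
  by (simp add: ones_mat_def ones_vec_def)

lemma ones_vec_scalar_prod:
  assumes "x \<in> carrier_vec n"
  shows "ones_vec n \<bullet> x = (\<Sum>i<n. x $ i)"
  using assms by (auto simp: ones_vec_def scalar_prod_def lessThan_atLeast0)

lemma nonneg_vec_iff:
  assumes "x \<in> carrier_vec n"
  shows "0\<^sub>v n \<le> x \<longleftrightarrow> (\<forall>i<n. (0::real) \<le> x $ i)"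
  using assms by (auto simp: less_eq_vec_def)

lemma in_std_simplex_iff:
  "x \<in> std_simplex n \<longleftrightarrow> x \<in> carrier_vec n \<and> (\<Sum>i<n. x $ i) = 1 \<and> (\<forall>i<n. 0 \<le> x $ i)"
  by (auto simp: std_simplex_def ones_vec_scalar_prod nonneg_vec_iff)

lemma sym_mats_index:
  assumes "M \<in> sym_mats n" "i < n" "j < n"
  shows "M $$ (i, j) = M $$ (j, i)"
proof -
  have "M \<in> carrier_mat n n" "M\<^sup>T = M"
    using assms(1) by (auto simp: sym_mats_def)
  then show ?thesis
    using assms(2,3) by (metis carrier_matD index_transpose_mat(1))
qed

lemma sym_matsI:
  assumes "M \<in> carrier_mat n n" "\<And>i j. i < n \<Longrightarrow> j < n \<Longrightarrow> M $$ (i, j) = M $$ (j, i)"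
  shows "M \<in> sym_mats n"
  using assms by (auto simp: sym_mats_def intro!: eq_matI)

section \<open>Gram matrices as separating functionals\<close>

text \<open>
  This is \<open>\<Sum>\<^sub>k v\<^sub>k v\<^sub>k\<^sup>T\<close>. The separating matrices below all have this form: the inner
  product with \<open>S\<close> then becomes a sum of values of the quadratic form of \<open>S\<close>, so that no
  spectral decomposition is needed.
\<close>
definition gram :: "nat \<Rightarrow> nat \<Rightarrow> (nat \<Rightarrow> real vec) \<Rightarrow> real mat" where
  "gram n m v = mat n n (\<lambda>(i, j). \<Sum>k<m. v k $ i * v k $ j)"

lemma trace_inner_gram:
  assumes "S \<in> carrier_mat n n" "\<And>k. v k \<in> carrier_vec n"
  shows "trace_inner S (gram n m v) = (\<Sum>k<m. quad_form S (v k))"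
proof -
  have "trace_inner S (gram n m v)
      = (\<Sum>i<n. \<Sum>j<n. \<Sum>k<m. S $$ (i, j) * (v k $ i * v k $ j))"
    using assms by (simp add: trace_inner_eq_sum[of _ n] gram_def sum_distrib_left)
  also have "\<dots> = (\<Sum>i<n. \<Sum>k<m. \<Sum>j<n. S $$ (i, j) * (v k $ i * v k $ j))"
    by (intro sum.cong refl sum.swap)
  also have "\<dots> = (\<Sum>k<m. \<Sum>i<n. \<Sum>j<n. S $$ (i, j) * (v k $ i * v k $ j))"
    by (rule sum.swap)
  finally show ?thesis
    using assms by (simp add: quad_form_eq_sum[of _ n])
qed

lemma gram_psd: "gram n m v \<in> psd_mats n"
proof -
  have sym: "gram n m v \<in> sym_mats n"
    by (rule sym_matsI) (auto simp: gram_def mult.commute)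
  have "0 \<le> quad_form (gram n m v) u" if u: "u \<in> carrier_vec n" for u
  proof -
    have "quad_form (gram n m v) u
        = (\<Sum>i<n. \<Sum>j<n. \<Sum>k<m. (v k $ i * u $ i) * (v k $ j * u $ j))"
      using u by (simp add: gram_def quad_form_eq_sum[of _ n] sum_distrib_left mult_ac)
    also have "\<dots> = (\<Sum>i<n. \<Sum>k<m. \<Sum>j<n. (v k $ i * u $ i) * (v k $ j * u $ j))"
      by (intro sum.cong refl sum.swap)
    also have "\<dots> = (\<Sum>k<m. \<Sum>i<n. \<Sum>j<n. (v k $ i * u $ i) * (v k $ j * u $ j))"
      by (rule sum.swap)
    also have "\<dots> = (\<Sum>k<m. (\<Sum>i<n. v k $ i * u $ i)\<^sup>2)"
      by (simp add: power2_eq_square sum_product)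
    also have "\<dots> \<ge> 0" by (simp add: sum_nonneg)
    finally show ?thesis .
  qed
  with sym show ?thesis by (simp add: psd_mats_def)
qed

lemma trace_inner_nonneg:
  assumes "N \<in> carrier_mat n n" "X \<in> carrier_mat n n" "nonneg_mat N" "nonneg_mat X"
  shows "0 \<le> trace_inner N X"
  using assms by (auto simp: trace_inner_eq_sum[of _ n] nonneg_mat_def intro!: sum_nonneg)

lemma not_SPN_if_gram:
  assumes v: "\<And>k. v k \<in> carrier_vec n" and nn: "nonneg_mat (gram n m v)"
    and neg: "(\<Sum>k<m. quad_form M (v k)) < 0"
  shows "M \<notin> SPN n"
proof
  assume "M \<in> SPN n"
  then obtain S N where M: "M = S + N" and S: "S \<in> psd_mats n"
    and N: "N \<in> sym_mats n" "nonneg_mat N"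
    by (auto simp: SPN_def)
  have Sc: "S \<in> carrier_mat n n" and Nc: "N \<in> carrier_mat n n"
    using S N by (auto simp: psd_mats_def sym_mats_def)
  have "0 \<le> (\<Sum>k<m. quad_form S (v k))"
    using S v by (auto simp: psd_mats_def intro!: sum_nonneg)
  moreover have "0 \<le> (\<Sum>k<m. quad_form N (v k))"
    using trace_inner_nonneg[OF Nc _ N(2) nn] trace_inner_gram[OF Nc v, of m]
    by (simp add: gram_def)
  ultimately show False
    using neg v by (simp add: M quad_form_add[OF Sc Nc] sum.distrib)
qed

section \<open>Attainment of the relaxed minimum\<close>

text \<open>
  The real content is that the minimum defining \<open>ell\<close> is attained. A feasible matrix has
  nonnegative entries with sum 1, so its entries lie in \<open>[0, 1]\<close>. Reading matrices as real
  functions on all index pairs, the feasible set becomes a closed subset of a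
  product of unit intervals, compact by Tychonoff's theorem; positive semidefiniteness is an intersection of
  closed half-spaces, one for each test vector.
\<close>
lemma ell_le:
  assumes Q: "Q \<in> carrier_mat n n"
    and X: "X \<in> DN n" "trace_inner (ones_mat n) X = 1"
  shows "ell n Q \<le> trace_inner Q X"
proof -
  define F where "F = {X \<in> DN n. trace_inner (ones_mat n) X = 1}"
  define obj :: "(nat \<times> nat \<Rightarrow> real) \<Rightarrow> real" where
    "obj f = (\<Sum>i<n. \<Sum>j<n. Q $$ (i, j) * f (i, j))" for f
  define K :: "(nat \<times> nat \<Rightarrow> real) set" where
    "K = (UNIV \<rightarrow>\<^sub>E {0..1}) \<inter> ({f. (\<Sum>i<n. \<Sum>j<n. f (i, j)) = 1}
       \<inter> (\<Inter>i. \<Inter>j. {f. f (i, j) = f (j, i)})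
       \<inter> (\<Inter>u. {f. 0 \<le> (\<Sum>i<n. \<Sum>j<n. f (i, j) * (u i * u j))}))"
  have cont: "continuous_on UNIV (\<lambda>f::nat \<times> nat \<Rightarrow> real. f z)" for z
    by (rule continuous_on_product_coordinates)
  have "compact (UNIV \<rightarrow>\<^sub>E {0..1} :: (nat \<times> nat \<Rightarrow> real) set)"
  proof -
    have "compactin (product_topology (\<lambda>_::nat \<times> nat. euclidean :: real topology) UNIV)
        (UNIV \<rightarrow>\<^sub>E {0..1})"
      by (subst compactin_PiE) simp
    then show ?thesis
      by (simp add: euclidean_product_topology)
  qed
  moreover have "closed ({f::nat \<times> nat \<Rightarrow> real. (\<Sum>i<n. \<Sum>j<n. f (i, j)) = 1}
       \<inter> (\<Inter>i. \<Inter>j. {f. f (i, j) = f (j, i)})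
       \<inter> (\<Inter>u. {f. 0 \<le> (\<Sum>i<n. \<Sum>j<n. f (i, j) * (u i * u j))}))"
    by (intro closed_Int closed_INT ballI closed_Collect_eq closed_Collect_le
        continuous_intros cont)
  ultimately have compact: "compact K"
    unfolding K_def by (rule compact_Int_closed)
  have toK: "\<exists>f\<in>K. trace_inner Q X = obj f" if X: "X \<in> F" for X
  proof
    \<comment> \<open>Symmetry is imposed at every index pair, so the extension beyond \<open>n\<close> must respect it.\<close>
    define f where "f = (\<lambda>(i, j). if i < n \<and> j < n then X $$ (i, j) else 0)"
    have XS: "X \<in> sym_mats n" and Xc: "X \<in> carrier_mat n n"
      and psd: "\<And>u. u \<in> carrier_vec n \<Longrightarrow> 0 \<le> quad_form X u"
      and nn: "\<And>i j. i < n \<Longrightarrow> j < n \<Longrightarrow> 0 \<le> X $$ (i, j)"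
      using X by (auto simp: F_def DN_def psd_mats_def sym_mats_def nonneg_mat_def)
    have total: "(\<Sum>i<n. \<Sum>j<n. X $$ (i, j)) = 1"
      using X by (simp add: F_def trace_inner_eq_sum[OF ones_mat_carrier])
    have le1: "X $$ (i, j) \<le> 1" if "i < n" "j < n" for i j
    proof -
      have "X $$ (i, j) \<le> (\<Sum>j<n. X $$ (i, j))"
        using that nn by (intro member_le_sum) auto
      also have "\<dots> \<le> (\<Sum>i<n. \<Sum>j<n. X $$ (i, j))"
        using that nn by (intro member_le_sum[of i _ "\<lambda>i. \<Sum>j<n. X $$ (i, j)"] sum_nonneg) auto
      finally show ?thesis using total by simp
    qed
    have q: "0 \<le> (\<Sum>i<n. \<Sum>j<n. f (i, j) * (u i * u j))" for u :: "nat \<Rightarrow> real"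
      using psd[of "vec n u"] Xc by (simp add: quad_form_eq_sum[of _ n] f_def)
    show "f \<in> K"
      using nn le1 total q sym_mats_index[OF XS] unfolding K_def
      by (auto simp: f_def PiE_iff)
    show "trace_inner Q X = obj f"
      using Q by (simp add: trace_inner_eq_sum[of _ n] obj_def f_def)
  qed
  have fromK: "\<exists>X\<in>F. trace_inner Q X = obj f" if f: "f \<in> K" for f
  proof
    have nn: "0 \<le> f z" for z
      using f by (cases z) (auto simp: K_def PiE_iff)
    have sym: "f (i, j) = f (j, i)" for i j
      using f by (auto simp: K_def)
    have total: "(\<Sum>i<n. \<Sum>j<n. f (i, j)) = 1"
      using f by (auto simp: K_def)
    have q: "0 \<le> (\<Sum>i<n. \<Sum>j<n. f (i, j) * (u i * u j))" for u :: "nat \<Rightarrow> real"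
      using f by (auto simp: K_def)
    have "mat n n f \<in> sym_mats n"
      by (rule sym_matsI) (auto simp: sym)
    then show "mat n n f \<in> F"
      using nn total q
      by (auto simp: F_def DN_def psd_mats_def nonneg_mat_def quad_form_eq_sum[of _ n]
          trace_inner_eq_sum[OF ones_mat_carrier])
    show "trace_inner Q (mat n n f) = obj f"
      using Q by (simp add: trace_inner_eq_sum[of _ n] obj_def)
  qed
  have XF: "X \<in> F" using X by (simp add: F_def)
  then have "K \<noteq> {}" using toK by blast
  moreover have "continuous_on K obj"
    unfolding obj_def
    by (intro continuous_intros continuous_on_subset[OF cont]) auto
  ultimately obtain f where f: "f \<in> K" "\<forall>g\<in>K. obj f \<le> obj g"
    using continuous_attains_inf[OF compact] by blast
  obtain Y where Y: "Y \<in> F" "trace_inner Q Y = obj f"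
    using fromK f(1) by blast
  have min: "obj f \<le> trace_inner Q Z" if "Z \<in> F" for Z
    using toK[OF that] f(2) by auto
  have "ell n Q = obj f"
    unfolding ell_def
  proof (rule Least_equality)
    show "obj f \<in> {trace_inner Q X |X. trace_inner (ones_mat n) X = 1 \<and> X \<in> DN n}"
      using Y by (force simp: F_def)
  next
    fix y assume "y \<in> {trace_inner Q X |X. trace_inner (ones_mat n) X = 1 \<and> X \<in> DN n}"
    then show "obj f \<le> y" using min by (auto simp: F_def)
  qed
  then show ?thesis using min[OF XF] by simp
qed

section \<open>Shifting by a multiple of the all-ones matrix\<close>

lemma quad_form_shift:
  assumes "M \<in> carrier_mat n n" "x \<in> std_simplex n"
  shows "quad_form (lam \<cdot>\<^sub>m ones_mat n + M) x = lam + quad_form M x"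
proof -
  have x: "x \<in> carrier_vec n" "(\<Sum>i<n. x $ i) = 1"
    using assms(2) by (auto simp: in_std_simplex_iff)
  have "quad_form (lam \<cdot>\<^sub>m ones_mat n) x = lam * ((\<Sum>i<n. x $ i) * (\<Sum>i<n. x $ i))"
    using x(1) by (subst quad_form_eq_sum[of _ n])
      (auto simp: sum_product sum_distrib_left sum_distrib_right mult_ac)
  then show ?thesis
    using assms(1) x by (simp add: quad_form_add[of _ n])
qed

lemma trace_inner_shift:
  assumes "M \<in> carrier_mat n n" "trace_inner (ones_mat n) X = 1"
  shows "trace_inner (lam \<cdot>\<^sub>m ones_mat n + M) X = lam + trace_inner M X"
proof -
  have "(\<Sum>i<n. \<Sum>j<n. X $$ (i, j)) = 1"
    using assms(2) by (simp add: trace_inner_eq_sum[OF ones_mat_carrier])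
  then show ?thesis
    using assms(1)
    by (simp add: trace_inner_eq_sum[of _ n] ring_distribs sum.distrib flip: sum_distrib_left)
qed

lemma nu_shift_bd_COP:
  assumes "M \<in> bd_COP n"
  shows "nu n (lam \<cdot>\<^sub>m ones_mat n + M) = lam"
  unfolding nu_def
proof (rule Least_equality)
  have Mc: "M \<in> carrier_mat n n"
    using assms by (auto simp: bd_COP_def COP_def sym_mats_def)
  obtain u where u: "u \<in> std_simplex n" "quad_form M u = 0"
    using assms by (auto simp: bd_COP_def)
  have "quad_form (lam \<cdot>\<^sub>m ones_mat n + M) u = lam"
    using quad_form_shift[OF Mc u(1)] u(2) by simp
  then show "lam \<in> {quad_form (lam \<cdot>\<^sub>m ones_mat n + M) x |x. x \<in> std_simplex n}"
    using u(1) by force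
  fix y assume "y \<in> {quad_form (lam \<cdot>\<^sub>m ones_mat n + M) x |x. x \<in> std_simplex n}"
  then obtain x where x: "x \<in> std_simplex n" "y = quad_form (lam \<cdot>\<^sub>m ones_mat n + M) x"
    by auto
  have "0 \<le> quad_form M x"
    using assms x(1) by (auto simp: bd_COP_def COP_def std_simplex_def)
  then show "lam \<le> y"
    using x quad_form_shift[OF Mc] by simp
qed

text \<open>
  The Gram matrix is feasible after division by its entry sum \<open>t\<close>. This sum cannot vanish: a
  nonnegative matrix with entry sum 0 is zero, and would not give a negative inner product.
\<close>
lemma ell_shift_less:
  assumes M: "M \<in> carrier_mat n n"
    and v: "\<And>k. v k \<in> carrier_vec n" and nn: "nonneg_mat (gram n m v)"
    and neg: "(\<Sum>k<m. quad_form M (v k)) < 0"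
  shows "ell n (lam \<cdot>\<^sub>m ones_mat n + M) < lam"
proof -
  define X where "X = gram n m v"
  define t where "t = (\<Sum>i<n. \<Sum>j<n. X $$ (i, j))"
  have Xc: "X \<in> carrier_mat n n" by (simp add: X_def gram_def)
  have Xn: "0 \<le> X $$ (i, j)" if "i < n" "j < n" for i j
    using nn Xc that by (auto simp: nonneg_mat_def X_def)
  have MX: "trace_inner M X < 0"
    using trace_inner_gram[OF M v] neg by (simp add: X_def)
  have "t \<noteq> 0"
  proof
    assume "t = 0"
    then have "\<forall>i<n. (\<Sum>j<n. X $$ (i, j)) = 0"
      using Xn unfolding t_def
      by (subst (asm) sum_nonneg_eq_0_iff) (auto intro!: sum_nonneg)
    then have "X $$ (i, j) = 0" if "i < n" "j < n" for i j
      using Xn that sum_nonneg_eq_0_iff[of "{..<n}" "\<lambda>j. X $$ (i, j)"] by auto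
    then have "trace_inner M X = 0"
      using M by (simp add: trace_inner_eq_sum[of _ n])
    with MX show False by simp
  qed
  moreover have "0 \<le> t"
    unfolding t_def using Xn by (intro sum_nonneg) auto
  ultimately have t: "0 < t" by simp
  \<comment> \<open>Scaling the vectors rather than the matrix leaves \<open>Y\<close> a Gram matrix, so \<open>gram_psd\<close> applies.\<close>
  define Y where "Y = gram n m (\<lambda>k. (1 / sqrt t) \<cdot>\<^sub>v v k)"
  have YX: "Y $$ (i, j) = X $$ (i, j) / t" if "i < n" "j < n" for i j
    using that t carrier_vecD[OF v]
    by (simp add: Y_def X_def gram_def sum_divide_distrib)
  have Yc: "Y \<in> carrier_mat n n" by (simp add: Y_def gram_def)
  have "Y \<in> DN n"
    unfolding DN_def using gram_psd Xn t Yc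
    by (auto simp: nonneg_mat_def YX) (simp add: Y_def gram_psd)
  moreover have one: "trace_inner (ones_mat n) Y = 1"
    using t by (simp add: trace_inner_eq_sum[OF ones_mat_carrier] YX t_def
        flip: sum_divide_distrib)
  moreover have "trace_inner M Y = trace_inner M X / t"
    using M by (simp add: trace_inner_eq_sum[of _ n] YX sum_divide_distrib)
  ultimately show ?thesis
    using ell_le[of "lam \<cdot>\<^sub>m ones_mat n + M" n Y] trace_inner_shift[OF M one, of lam] M MX t
    by (smt (verit) add_carrier_mat divide_neg_pos)
qed

section \<open>The Horn matrix\<close>

lemma horn_mat_carrier: "horn_mat \<in> carrier_mat 5 5"
  by (simp add: horn_mat_def mat_of_rows_list_def numeral_eq_Suc)

lemma quad_form_horn:
  assumes "z \<in> carrier_vec 5"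
  shows "quad_form horn_mat z =
    (z$0)\<^sup>2 + (z$1)\<^sup>2 + (z$2)\<^sup>2 + (z$3)\<^sup>2 + (z$4)\<^sup>2
    - 2 * (z$0 * z$1 + z$1 * z$2 + z$2 * z$3 + z$3 * z$4 + z$4 * z$0)
    + 2 * (z$0 * z$2 + z$1 * z$3 + z$2 * z$4 + z$3 * z$0 + z$4 * z$1)"
  using horn_mat_carrier assms
    by (simp add: quad_form_eq_sum[of _ 5] horn_mat_def mat_of_rows_list_def
        lessThan_nat_numeral lessThan_Suc eval_nat_numeral power2_eq_square algebra_simps)

text \<open>
  The square of a linear form with coefficients \<open>\<plusminus>1\<close> reproduces the Horn form except at the
  pairs of indices where the product of signs is not the entry of the matrix. For the signs
  chosen here three pairs disagree, and the only negative correction (\<open>-4 z\<^sub>2 z\<^sub>3\<close>, or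
  \<open>-4 z\<^sub>0 z\<^sub>4\<close>) is absorbed by a positive one according to the order of \<open>z\<^sub>3\<close> and \<open>z\<^sub>4\<close>.
\<close>
lemma horn_nonneg:
  assumes "z \<in> carrier_vec 5" "\<forall>i<5. 0 \<le> z $ i"
  shows "0 \<le> quad_form horn_mat z"
proof -
  have nn: "0 \<le> z$0" "0 \<le> z$1" "0 \<le> z$2" "0 \<le> z$3" "0 \<le> z$4"
    using assms(2) by auto
  show ?thesis
  proof (cases "z$3 \<le> z$4")
    case True
    have "quad_form horn_mat z = (z$0 - z$1 + z$2 + z$3 - z$4)\<^sup>2
        + 4 * (z$1 * z$3) + 4 * (z$2 * (z$4 - z$3))"
      unfolding quad_form_horn[OF assms(1)] by (simp add: power2_eq_square algebra_simps)
    then show ?thesis using nn True by simp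
  next
    case False
    have "quad_form horn_mat z = (z$0 - z$1 + z$2 - z$3 + z$4)\<^sup>2
        + 4 * (z$1 * z$4) + 4 * (z$0 * (z$3 - z$4))"
      unfolding quad_form_horn[OF assms(1)] by (simp add: power2_eq_square algebra_simps)
    then show ?thesis using nn False by simp
  qed
qed

text \<open>
  The generator has the shape \<open>(2q, q, -s, -s, q)\<close>. The Gram matrix of its rotations has the entry
  \<open>q\<^sup>2 - 6 q s\<close> at cyclic distance 2, which \<open>q = 6\<close>, \<open>s = 1\<close> makes zero, and its inner product
  with the Horn matrix is \<open>-40 q s\<close>.
\<close>
definition cyc_vec :: "nat \<Rightarrow> real vec" where
  "cyc_vec k = vec 5 (\<lambda>i. [12, 6, -1, -1, 6] ! ((i + k) mod 5))"

lemma cyc_vec_carrier [simp]: "cyc_vec k \<in> carrier_vec 5"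
  by (simp add: cyc_vec_def)

lemma less_5_iff: "(i::nat) < 5 \<longleftrightarrow> i = 0 \<or> i = 1 \<or> i = 2 \<or> i = 3 \<or> i = 4"
  by auto

lemma sum_5: "(\<Sum>k<5. f k) = f 0 + f 1 + f 2 + f 3 + f (4::nat)" for f :: "nat \<Rightarrow> real"
  by (simp add: eval_nat_numeral)

lemma horn_cyc_neg: "(\<Sum>k<5. quad_form horn_mat (cyc_vec k)) < 0"
  by (simp add: quad_form_horn cyc_vec_def sum_5)

lemma cyc_gram_nonneg:
  assumes "i < 5" "j < 5"
  shows "0 \<le> (\<Sum>k<5. cyc_vec k $ i * cyc_vec k $ j)"
  using assms by (auto simp: less_5_iff cyc_vec_def sum_5)

section \<open>Bordering by a copositive and a nonnegative block\<close>

lemma quad_form_four_block: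
  assumes B: "B \<in> carrier_mat a a" and C: "C \<in> carrier_mat a b" and H: "H \<in> carrier_mat b b"
    and y: "y \<in> carrier_vec a" and z: "z \<in> carrier_vec b"
  shows "quad_form (four_block_mat B C C\<^sup>T H) (y @\<^sub>v z)
    = quad_form B y + 2 * (y \<bullet> (C *\<^sub>v z)) + quad_form H z"
proof -
  have "z \<bullet> (C\<^sup>T *\<^sub>v y) = y \<bullet> (C *\<^sub>v z)"
    using transpose_vec_mult_scalar[OF C z y] C y z
    by (simp add: comm_scalar_prod[of _ b])
  moreover have "four_block_mat B C C\<^sup>T H *\<^sub>v (y @\<^sub>v z)
      = (B *\<^sub>v y + C *\<^sub>v z) @\<^sub>v (C\<^sup>T *\<^sub>v y + H *\<^sub>v z)"
    using B C H y z by (intro four_block_mat_mult_vec) auto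
  ultimately show ?thesis
    using B C H y z unfolding quad_form_def
    by (simp add: scalar_prod_append[of _ a _ b] scalar_prod_add_distrib[of _ a]
        scalar_prod_add_distrib[of _ b])
qed

lemma four_block_COP:
  assumes B: "B \<in> COP a" and C: "C \<in> carrier_mat a b" "nonneg_mat C" and H: "H \<in> COP b"
  shows "four_block_mat B C C\<^sup>T H \<in> COP (a + b)"
proof -
  have Bc: "B \<in> carrier_mat a a" "B \<in> sym_mats a" and Hc: "H \<in> carrier_mat b b" "H \<in> sym_mats b"
    using B H by (auto simp: COP_def sym_mats_def)
  have sym: "four_block_mat B C C\<^sup>T H \<in> sym_mats (a + b)"
    using Bc Hc C(1) sym_mats_index[OF Bc(2)] sym_mats_index[OF Hc(2)]
    by (intro sym_matsI) auto
  have "0 \<le> quad_form (four_block_mat B C C\<^sup>T H) u"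
    if u: "u \<in> carrier_vec (a + b)" "0\<^sub>v (a + b) \<le> u" for u
  proof -
    define y z where "y = vec_first u a" and "z = vec_last u b"
    have yz: "y \<in> carrier_vec a" "z \<in> carrier_vec b" "u = y @\<^sub>v z"
      using u(1) by (auto simp: y_def z_def)
    have nn: "\<forall>i<a+b. 0 \<le> u $ i"
      using u by (simp add: nonneg_vec_iff)
    have y0: "\<forall>i<a. 0 \<le> y $ i" and z0: "\<forall>i<b. 0 \<le> z $ i"
      using nn u(1) by (auto simp: y_def z_def vec_first_def vec_last_def)
    have "0 \<le> y \<bullet> (C *\<^sub>v z)"
      using y0 z0 C yz(1,2)
      by (auto simp: scalar_prod_def nonneg_mat_def intro!: sum_nonneg mult_nonneg_nonneg)
    moreover have "0 \<le> quad_form B y" "0 \<le> quad_form H z"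
      using B H yz y0 z0 by (auto simp: COP_def nonneg_vec_iff)
    ultimately show ?thesis
      using quad_form_four_block[OF Bc(1) C(1) Hc(1) yz(1,2)] yz(3) by simp
  qed
  with sym show ?thesis by (simp add: COP_def)
qed

lemma horn_COP: "horn_mat \<in> COP 5"
proof -
  have "horn_mat \<in> sym_mats 5"
    by (rule sym_matsI) (auto simp: less_5_iff horn_mat_def mat_of_rows_list_def)
  then show ?thesis using horn_nonneg by (auto simp: COP_def nonneg_vec_iff)
qed

section \<open>Permuting and rescaling the coordinates\<close>

text \<open>
  Indexing the result by \<open>p a\<close> and \<open>p b\<close> turns the congruence into a plain rescaling of entries, so
  that symmetry and the values of the quadratic form follow by reindexing along \<open>p\<close>.
\<close>
lemma index_monomial_congruence:
  fixes J D A :: "real mat"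
  assumes p: "p permutes {..<n}" and J: "J = mat n n (\<lambda>(i, j). if i = p j then 1 else 0)"
    and D: "D \<in> carrier_mat n n" "diagonal_mat D" and A: "A \<in> carrier_mat n n"
    and ab: "a < n" "b < n"
  shows "(J * D * A * D * J\<^sup>T) $$ (p a, p b) = D $$ (a, a) * A $$ (a, b) * D $$ (b, b)"
proof -
  have pl: "p i < n" if "i < n" for i
    using permutes_in_image[OF p] that by simp
  have pinj: "p i = p j \<longleftrightarrow> i = j" for i j
    using permutes_inj[OF p] by (auto dest: injD)
  have Jc: "J \<in> carrier_mat n n" by (simp add: J)
  define d where "d i = D $$ (i, i)" for i
  have Dij: "D $$ (i, j) = (if i = j then d i else 0)" if "i < n" "j < n" for i j
    using D that by (auto simp: diagonal_mat_def d_def)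
  have delta: "(if b then x else 0) * y = (if b then x * y else 0)"
    "y * (if b then x else 0) = (if b then y * x else 0)" for b and x y :: real
    by simp_all
  have left: "(J * Y) $$ (p i, j) = Y $$ (i, j)"
    if "Y \<in> carrier_mat n n" "i < n" "j < n" for Y i j
    using that Jc pl by (simp add: scalar_prod_def J pinj delta)
  have right: "(Y * J\<^sup>T) $$ (i, p j) = Y $$ (i, j)"
    if "Y \<in> carrier_mat n n" "i < n" "j < n" for Y i j
    using that Jc pl by (simp add: scalar_prod_def J pinj delta)
  have DY: "(D * Y) $$ (i, j) = d i * Y $$ (i, j)"
    if "Y \<in> carrier_mat n n" "i < n" "j < n" for Y i j
    using that D by (simp add: scalar_prod_def Dij delta)
  have YD: "(Y * D) $$ (i, j) = Y $$ (i, j) * d j"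
    if "Y \<in> carrier_mat n n" "i < n" "j < n" for Y i j
    using that D by (simp add: scalar_prod_def Dij delta)
  have AD: "A * D \<in> carrier_mat n n" and DAD: "D * (A * D) \<in> carrier_mat n n"
    and DADJ: "D * (A * D) * J\<^sup>T \<in> carrier_mat n n"
    using A D(1) Jc by auto
  have "J * D * A * D * J\<^sup>T = J * (D * (A * D) * J\<^sup>T)"
    using Jc D(1) A by (simp add: assoc_mult_mat[of _ n n _ n _ n])
  then have "(J * D * A * D * J\<^sup>T) $$ (p a, p b) = (J * (D * (A * D) * J\<^sup>T)) $$ (p a, p b)"
    by (rule arg_cong)
  also have "\<dots> = (D * (A * D) * J\<^sup>T) $$ (a, p b)"
    by (rule left[OF DADJ ab(1) pl[OF ab(2)]])
  also have "\<dots> = (D * (A * D)) $$ (a, b)"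
    by (rule right[OF DAD ab])
  also have "\<dots> = d a * (A $$ (a, b) * d b)"
    unfolding DY[OF AD ab] YD[OF A ab] ..
  finally show ?thesis by (simp add: d_def)
qed


lemma quad_form_monomial_congruence:
  assumes p: "p permutes {..<n}" and J: "J = mat n n (\<lambda>(i, j). if i = p j then 1 else 0)"
    and D: "D \<in> carrier_mat n n" "diagonal_mat D" and A: "A \<in> carrier_mat n n"
    and u: "u \<in> carrier_vec n"
  shows "quad_form (J * D * A * D * J\<^sup>T) u = quad_form A (vec n (\<lambda>a. D $$ (a, a) * u $ p a))"
proof -
  let ?M = "J * D * A * D * J\<^sup>T"
  have Mc: "?M \<in> carrier_mat n n"
    using D A J by auto
  have perm: "(\<Sum>i<n. f i) = (\<Sum>a<n. f (p a))" for f :: "nat \<Rightarrow> real"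
    using sum.permute[OF p, of f] by simp
  have "quad_form ?M u = (\<Sum>a<n. \<Sum>b<n. ?M $$ (p a, p b) * (u $ p a * u $ p b))"
    by (subst quad_form_eq_sum[OF Mc u], subst perm, rule sum.cong[OF refl], rule perm)
  also have "\<dots> = (\<Sum>a<n. \<Sum>b<n. A $$ (a, b) * ((D $$ (a, a) * u $ p a) * (D $$ (b, b) * u $ p b)))"
    using index_monomial_congruence[OF p J D A] by (simp add: mult_ac)
  also have "\<dots> = quad_form A (vec n (\<lambda>a. D $$ (a, a) * u $ p a))"
    using A by (simp add: quad_form_eq_sum[of _ n])
  finally show ?thesis .
qed

lemma monomial_congruence_sym:
  assumes p: "p permutes {..<n}" and J: "J = mat n n (\<lambda>(i, j). if i = p j then 1 else 0)"
    and D: "D \<in> carrier_mat n n" "diagonal_mat D" and A: "A \<in> sym_mats n"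
  shows "J * D * A * D * J\<^sup>T \<in> sym_mats n"
proof (rule sym_matsI)
  have Ac: "A \<in> carrier_mat n n" using A by (simp add: sym_mats_def)
  show "J * D * A * D * J\<^sup>T \<in> carrier_mat n n"
    using D Ac J by auto
  fix i j assume "i < n" "j < n"
  then obtain a b where "a < n" "b < n" "i = p a" "j = p b"
    using permutes_image[OF p] by (metis imageE lessThan_iff)
  then show "(J * D * A * D * J\<^sup>T) $$ (i, j) = (J * D * A * D * J\<^sup>T) $$ (j, i)"
    using index_monomial_congruence[OF p J D Ac] sym_mats_index[OF A] by simp
qed

section \<open>The Horn-based family has a strict relaxation gap\<close>

lemma bd_COP_if_zero:
  assumes M: "M \<in> COP n" and u: "u \<in> carrier_vec n" "\<forall>i<n. 0 \<le> u $ i"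
    and pos: "j < n" "0 < u $ j" and zero: "quad_form M u = 0"
  shows "M \<in> bd_COP n"
proof -
  have Mc: "M \<in> carrier_mat n n" using M by (auto simp: COP_def sym_mats_def)
  define t where "t = (\<Sum>i<n. u $ i)"
  have t: "0 < t"
    unfolding t_def using u pos by (intro sum_pos2[of _ j]) auto
  have "(1 / t) \<cdot>\<^sub>v u \<in> std_simplex n"
    using u t by (auto simp: in_std_simplex_iff t_def simp flip: sum_divide_distrib)
  moreover have "quad_form M ((1 / t) \<cdot>\<^sub>v u) = 0"
    using quad_form_smult_vec[OF Mc u(1)] zero by simp
  ultimately show ?thesis using M by (auto simp: bd_COP_def)
qed

theorem mainTheorem11:
  fixes n :: nat and B C J D Mhat M Q :: "real mat" and lam :: real
  assumes "n \<ge> 5"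
    and "B \<in> COP (n - 5)"
    and "C \<in> carrier_mat (n - 5) 5" and "nonneg_mat C"
    and "permutation_mat n J"
    and "D \<in> sym_mats n" and "diagonal_mat D" and "\<forall>i<n. 0 < D $$ (i, i)"
    and "Mhat = four_block_mat B C C\<^sup>T horn_mat"
    and "M = J * D * Mhat * D * J\<^sup>T"
    and "Q = lam \<cdot>\<^sub>m ones_mat n + M"
  shows "M \<in> bd_COP n - SPN n
    \<and> Q \<in> sym_mats n - exact_mats n
    \<and> ell n Q < nu n Q
    \<and> nu n Q = lam
    \<and> Omega n Q = zero_set n M"
proof -
  obtain p where p: "p permutes {..<n}" and J: "J = mat n n (\<lambda>(i, j). if i = p j then 1 else 0)"
    using assms(5) by (auto simp: permutation_mat_def)
  define q where "q = inv_into UNIV p"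
  have qp: "q (p a) = a" and pq: "p (q a) = a" for a
    using permutes_inverses[OF p] by (simp_all add: q_def)
  have pl: "p i < n" if "i < n" for i
    using permutes_in_image[OF p] that by simp
  have ql: "q i < n" if "i < n" for i
    using permutes_in_image[OF permutes_inv[OF p]] that by (simp add: q_def)
  have D: "D \<in> carrier_mat n n" "diagonal_mat D" and d: "\<And>i. i < n \<Longrightarrow> 0 < D $$ (i, i)"
    using assms(6-8) by (auto simp: sym_mats_def)
  have n: "n - 5 + 5 = n" using assms(1) by simp
  have Bc: "B \<in> carrier_mat (n - 5) (n - 5)" using assms(2) by (auto simp: COP_def sym_mats_def)
  have hat: "Mhat \<in> COP n"
    using four_block_COP[OF assms(2,3,4) horn_COP] by (simp add: assms(9) n)
  then have hatS: "Mhat \<in> sym_mats n" and hatc: "Mhat \<in> carrier_mat n n"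
    by (auto simp: COP_def sym_mats_def)
  have MS: "M \<in> sym_mats n"
    unfolding assms(10) by (rule monomial_congruence_sym[OF p J D hatS])
  then have Mc: "M \<in> carrier_mat n n" by (simp add: sym_mats_def)
  have qM: "quad_form M u = quad_form Mhat (vec n (\<lambda>a. D $$ (a, a) * u $ p a))"
    if "u \<in> carrier_vec n" for u
    unfolding assms(10) by (rule quad_form_monomial_congruence[OF p J D hatc that])
  have cop: "M \<in> COP n"
    using MS hat d pl unfolding COP_def
    by (auto simp: qM nonneg_vec_iff less_imp_le)
  \<comment> \<open>This is \<open>J D\<^sup>-\<^sup>1 (0; z)\<close>: the congruence maps it back to the padded vector \<open>(0; z)\<close>.\<close>
  define lift where "lift z = vec n (\<lambda>i. (0\<^sub>v (n - 5) @\<^sub>v z) $ q i / D $$ (q i, q i))" for z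
  have liftc: "lift z \<in> carrier_vec n" for z
    by (simp add: lift_def)
  have lift_pa: "lift z $ p a = (0\<^sub>v (n - 5) @\<^sub>v z) $ a / D $$ (a, a)" if "a < n" for z a
    using that pl by (simp add: lift_def qp)
  have lift_split: "lift z $ p a = (if a < n - 5 then 0 else z $ (a - (n - 5)) / D $$ (a, a))"
    if "z \<in> carrier_vec 5" "a < n" for z a
    using that n by (subst lift_pa) auto
  have lift_quad: "quad_form M (lift z) = quad_form horn_mat z" if z: "z \<in> carrier_vec 5" for z
  proof -
    have "vec n (\<lambda>a. D $$ (a, a) * lift z $ p a) = 0\<^sub>v (n - 5) @\<^sub>v z"
      using z n d by (intro eq_vecI) (auto simp: lift_pa less_imp_neq[symmetric])
    then have "quad_form M (lift z) = quad_form Mhat (0\<^sub>v (n - 5) @\<^sub>v z)"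
      by (simp add: qM[OF liftc])
    moreover have "quad_form B (0\<^sub>v (n - 5)) = 0"
      using Bc by (simp add: quad_form_def)
    ultimately show ?thesis
      using quad_form_four_block[OF Bc assms(3) horn_mat_carrier zero_carrier_vec z] z assms(3)
      by (simp add: assms(9))
  qed
  have bd: "M \<in> bd_COP n"
  proof (rule bd_COP_if_zero[OF cop])
    \<comment> \<open>The Horn form vanishes at \<open>e\<^sub>1 + e\<^sub>2\<close>, since \<open>H\<^sub>1\<^sub>1 + 2 H\<^sub>1\<^sub>2 + H\<^sub>2\<^sub>2 = 0\<close>.\<close>
    define z :: "real vec" where "z = vec 5 (\<lambda>i. if i \<le> 1 then 1 else 0)"
    have z: "z \<in> carrier_vec 5" by (simp add: z_def)
    show "lift z \<in> carrier_vec n" by (rule liftc)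
    show "quad_form M (lift z) = 0"
      unfolding lift_quad[OF z] quad_form_horn[OF z] by (simp add: z_def)
    note lz = lift_split[OF z]
    have "0 \<le> lift z $ p a" if "a < n" for a
      unfolding lz[OF that] using that n d[OF that] by (auto simp: z_def)
    then show "\<forall>i<n. 0 \<le> lift z $ i"
      using pq ql by metis
    have last: "n - 5 < n" using assms(1) by simp
    show "p (n - 5) < n" by (rule pl[OF last])
    show "0 < lift z $ p (n - 5)"
      unfolding lz[OF last] using d[OF last] by (simp add: z_def)
  qed
  define v where "v k = lift (cyc_vec k)" for k
  have vc: "v k \<in> carrier_vec n" for k
    by (simp add: v_def liftc)
  have neg: "(\<Sum>k<5. quad_form M (v k)) < 0"
    using horn_cyc_neg by (simp add: v_def lift_quad)
  have nn: "nonneg_mat (gram n 5 v)"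
  proof -
    have "0 \<le> (\<Sum>k<5. v k $ p a * v k $ p b)" if ab: "a < n" "b < n" for a b
    proof (cases "a < n - 5 \<or> b < n - 5")
      case True
      then have "(\<Sum>k<5. v k $ p a * v k $ p b) = 0"
        using ab n by (intro sum.neutral) (auto simp: v_def lift_split)
      then show ?thesis by simp
    next
      case False
      then have "(\<Sum>k<5. v k $ p a * v k $ p b)
          = (\<Sum>k<5. cyc_vec k $ (a - (n - 5)) * cyc_vec k $ (b - (n - 5)))
            / (D $$ (a, a) * D $$ (b, b))"
        using ab by (simp add: v_def lift_split sum_divide_distrib)
      moreover have "0 \<le> (\<Sum>k<5. cyc_vec k $ (a - (n - 5)) * cyc_vec k $ (b - (n - 5)))"
        using False ab n by (intro cyc_gram_nonneg) auto
      ultimately show ?thesis using d[OF ab(1)] d[OF ab(2)] by simp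
    qed
    then show ?thesis
      unfolding nonneg_mat_def gram_def using pq ql by simp metis
  qed
  have notSPN: "M \<notin> SPN n" by (rule not_SPN_if_gram[OF vc nn neg])
  have nu: "nu n Q = lam" unfolding assms(11) by (rule nu_shift_bd_COP[OF bd])
  have ell: "ell n Q < lam" unfolding assms(11) by (rule ell_shift_less[OF Mc vc nn neg])
  have QS: "Q \<in> sym_mats n"
    unfolding assms(11) using Mc sym_mats_index[OF MS] by (intro sym_matsI) auto
  have "Omega n Q = zero_set n M"
    unfolding Omega_def zero_set_def nu using quad_form_shift[OF Mc]
    by (auto simp: assms(11))
  with bd notSPN nu ell QS show ?thesis by (simp add: exact_mats_def)
qed

end
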